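(* Let $\theta : \mathbb{R}^+ \to \mathbb{R}^+$ be an increasing and subadditive map such that $\theta(0) = 0$ and $\theta(x) \to 1$ as $x \to +\infty$. Assume that $\theta$ is absolutely continuous, and that there exist $\alpha, m, M > 0$ and a constant $C > 0$ such that \[ \theta(t) \le C\, t^{\alpha} \ \text{ for all } 0 < t < m, \qquad 1 - \theta(t) \le C\, t^{-\alpha} \ \text{ for all } t > M. \] Then, for every summable sequence $r = (r_n)_{n \ge 0}$ of positive real numbers, and for all increasing sequences $a = (a_n)_{n \ge 0}$ and $b = (b_n)_{n \ge 0}$ of positive real numbers, we have \[ \left( \forall t > 0, \quad \sum_{n \ge 0} r_n\, \theta(t a_n) = \sum_{n \ge 0} r_n\, \theta(t b_n) \right) \implies a = b. \]
   Context: $\mathbb{R}^+ = [0,+\infty)$. "Increasing" is understood in the weak sense (non-decreasing), and "positive" means $> 0$. Subadditive means $\theta(s+t) \le \theta(s) + \theta(t)$ for all $s,t \ge 0$. The definition of absolute continuity used is: a map $\theta : I \subset \mathbb{R} \to \mathbb{R}$ is absolutely continuous if $\theta$ has a derivative $\theta'$ almost everywhere which is integrable in $I$. *)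

theory Defs
  imports "HOL-Analysis.Analysis"
begin

text \<open>
  The source explicitly takes the following as its definition of absolute continuity. It does not
  require the primitive of the derivative to recover the function, so it is weaker than the usual
  epsilon-delta notion.
  The derivative is taken within the domain \<open>I\<close>, hence values outside \<open>I\<close> are irrelevant.
\<close>
definition absolutely_continuous_map_on :: "real set \<Rightarrow> (real \<Rightarrow> real) \<Rightarrow> bool" where
  "absolutely_continuous_map_on I \<theta> \<longleftrightarrow>
     (\<exists>\<theta>'. (AE x in lebesgue. x \<in> I \<longrightarrow> (\<theta> has_real_derivative \<theta>' x) (at x within I)) \<and>
           \<theta>' absolutely_integrable_on I)"

end

theory Submission
  imports Defs "HOL-Probability.Probability" "HOL-Complex_Analysis.Complex_Analysis"
begin

text \<open>
  Subadditivity and the bound at \<open>0\<close> make \<open>\<theta>\<close> right-continuous, so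
  \<open>F u = \<theta> (exp u)\<close> is the distribution function of a probability measure \<open>D\<close> on the line; the
  bounds at \<open>0\<close> and \<open>\<infinity>\<close> say that \<open>D\<close> has exponential tails. Up to normalisation and the
  substitution \<open>t = exp u\<close>, the series for \<open>a\<close> is the distribution function of the convolution of
  \<open>D\<close> with the discrete law having mass \<open>r n\<close> at \<open>- ln (a n)\<close>, and likewise for \<open>b\<close>. The characteristic
  function of \<open>D\<close> extends holomorphically to a strip, hence vanishes on no interval and can be
  cancelled by continuity. So the two discrete laws agree, and since the masses are positive, a
  monotone sequence can be read off from its law.
\<close>

text \<open>Expand \<open>exp ((z - w) * x)\<close> in its power series and integrate term by term.
  Since \<open>w\<close> is purely imaginary, \<open>exp (w * x)\<close> has modulus 1, so the norms
  of the terms add up to \<open>exp (norm (z - w) * \<bar>x\<bar>)\<close>, which the integrable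
  function \<open>exp (c * \<bar>x\<bar>)\<close> dominates.\<close>

lemma (in finite_borel_measure) moment_power_series:
  fixes w z :: complex
  assumes int: "integrable M (\<lambda>x::real. exp (c * \<bar>x\<bar>))"
    and w: "Re w = 0" and z: "z \<in> ball w c"
  shows "(\<lambda>k. (\<integral>x. exp (w * of_real x) * of_real (x ^ k / fact k) \<partial>M) * (z - w) ^ k)
           sums (\<integral>x. exp (z * of_real x) \<partial>M)"
proof -
  note [measurable_cong] = M_is_borel
  define g where "g k x = exp (w * of_real x) * of_real (x ^ k / fact k) * (z - w) ^ k" for k and x :: real
  have g_meas [measurable]: "g k \<in> borel_measurable M" for k
    unfolding g_def by measurable
  have nz: "norm (z - w) < c"
    using z by (simp add: dist_norm norm_minus_commute)
  have norm_g: "norm (g k x) = (norm (z - w) * \<bar>x\<bar>) ^ k / fact k" for k x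
    using w by (simp add: g_def norm_mult norm_power norm_divide power_mult_distrib)
  have sums_norm: "(\<lambda>k. norm (g k x)) sums exp (norm (z - w) * \<bar>x\<bar>)" for x
    unfolding norm_g using exp_converges[of "norm (z - w) * \<bar>x\<bar>"]
    by (simp add: divide_inverse mult.commute)
  \<comment> \<open>This bound serves twice: a singleton \<open>A\<close> makes each term
    integrable, and \<open>A = {..<n}\<close> bounds the partial sums of the integrals of the
    norms.\<close>
  have partial_le: "(\<Sum>k\<in>A. norm (g k x)) \<le> exp (c * \<bar>x\<bar>)" if "finite A" for A x
  proof -
    have "(\<Sum>k\<in>A. norm (g k x)) \<le> (\<Sum>k. norm (g k x))"
      using sums_norm[of x] that by (intro sum_le_suminf) (auto simp: sums_iff)
    also have "\<dots> = exp (norm (z - w) * \<bar>x\<bar>)"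
      using sums_norm[of x] by (simp add: sums_iff)
    also have "\<dots> \<le> exp (c * \<bar>x\<bar>)"
      using nz by (simp add: mult_right_mono)
    finally show ?thesis .
  qed
  have g_int: "integrable M (g k)" for k
    by (rule Bochner_Integration.integrable_bound[OF int])
      (use partial_le[of "{k}"] in auto)
  have "(\<lambda>k. \<integral>x. g k x \<partial>M) sums (\<integral>x. (\<Sum>k. g k x) \<partial>M)"
  proof (rule sums_integral)
    show "integrable M (g k)" for k by (rule g_int)
    show "AE x in M. summable (\<lambda>k. norm (g k x))"
      using sums_norm by (auto simp: sums_iff)
    show "summable (\<lambda>k. \<integral>x. norm (g k x) \<partial>M)"
    proof (rule summableI_nonneg_bounded)
      fix n
      have "(\<Sum>k<n. \<integral>x. norm (g k x) \<partial>M) = (\<integral>x. (\<Sum>k<n. norm (g k x)) \<partial>M)"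
        using g_int by (subst Bochner_Integration.integral_sum) auto
      also have "\<dots> \<le> (\<integral>x. exp (c * \<bar>x\<bar>) \<partial>M)"
        using g_int int partial_le
        by (intro integral_mono) auto
      finally show "(\<Sum>k<n. \<integral>x. norm (g k x) \<partial>M) \<le> (\<integral>x. exp (c * \<bar>x\<bar>) \<partial>M)" .
    qed simp
  qed
  moreover have "(\<Sum>k. g k x) = exp (z * of_real x)" for x
  proof -
    have "(\<lambda>k. exp (w * of_real x) * (((z - w) * of_real x) ^ k /\<^sub>R fact k))
            sums (exp (w * of_real x) * exp ((z - w) * of_real x))"
      by (intro sums_mult exp_converges)
    moreover have "exp (w * of_real x) * (((z - w) * of_real x) ^ k /\<^sub>R fact k) = g k x" for k
      by (simp add: g_def power_mult_distrib scaleR_conv_of_real divide_inverse mult_ac)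
    moreover have "exp (w * of_real x) * exp ((z - w) * of_real x) = exp (z * of_real x)"
      by (simp add: exp_add[symmetric] algebra_simps)
    ultimately show ?thesis by (simp add: sums_iff)
  qed
  moreover have "(\<integral>x. g k x \<partial>M)
      = (\<integral>x. exp (w * of_real x) * of_real (x ^ k / fact k) \<partial>M) * (z - w) ^ k" for k
    unfolding g_def by (rule integral_mult_left_zero)
  ultimately show ?thesis by simp
qed

text \<open>Every point of the strip lies within distance \<open>c\<close> of its projection
  \<open>w\<close> to the imaginary axis, and the integral is a power series on the ball of radius
  \<open>c\<close> around \<open>w\<close>.\<close>

lemma (in finite_borel_measure) holomorphic_on_moment_generating:
  assumes "integrable M (\<lambda>x. exp (c * \<bar>x\<bar>))"
  shows "(\<lambda>z. \<integral>x. exp (z * of_real x) \<partial>M) holomorphic_on {z. \<bar>Re z\<bar> < c}"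
proof -
  let ?f = "\<lambda>z::complex. \<integral>x. exp (z * of_real x) \<partial>M"
  have "?f field_differentiable at z" if "\<bar>Re z\<bar> < c" for z
  proof -
    define w where "w = \<i> * of_real (Im z)"
    have "dist w z = \<bar>Re z\<bar>"
      by (simp add: w_def dist_norm cmod_def)
    then have "z \<in> ball w c" using that by simp
    moreover have "?f holomorphic_on ball w c"
      by (rule power_series_holomorphic[OF moment_power_series[OF assms]])
        (simp_all add: w_def)
    ultimately show ?thesis
      using holomorphic_on_imp_differentiable_at by blast
  qed
  then show ?thesis
    by (auto simp: holomorphic_on_def intro: field_differentiable_at_within)
qed

text \<open>If the characteristic functions of \<open>M1\<close> and \<open>M2\<close> differed at
  some \<open>t\<close>, they would differ on an interval around \<open>t\<close>, and
  \<open>char D\<close> would vanish there. By the identity theorem its holomorphic extension would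
  vanish on the whole strip, contradicting the value 1 at 0.\<close>

lemma char_cancel_right:
  assumes M1: "real_distribution M1" and M2: "real_distribution M2" and D: "real_distribution D"
    and c: "c > 0" and int: "integrable D (\<lambda>x. exp (c * \<bar>x\<bar>))"
    and eq: "\<And>t. char M1 t * char D t = char M2 t * char D t"
  shows "M1 = M2"
proof (rule Levy_uniqueness[OF M1 M2], rule ext, rule ccontr)
  fix t assume neq: "char M1 t \<noteq> char M2 t"
  interpret D: real_distribution D by fact
  let ?S = "{z. \<bar>Re z\<bar> < c}"
  let ?f = "\<lambda>z::complex. \<integral>x. exp (z * of_real x) \<partial>D"
  have f_char: "?f (\<i> * of_real s) = char D s" for s
    by (simp add: char_def mult.assoc)
  have "isCont (\<lambda>s. char M1 s - char M2 s) t"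
    using M1 M2 by (intro continuous_intros real_distribution.isCont_char)
  from continuous_at_avoid[OF this, of 0] neq
  obtain e where e: "e > 0" "\<And>s. dist t s < e \<Longrightarrow> char M1 s \<noteq> char M2 s"
    by auto
  \<comment> \<open>\<open>U\<close> is a segment of the imaginary axis and has no interior in the
    plane, so the identity theorem is used in its limit point form, with the limit point
    \<open>\<i> * of_real t\<close>.\<close>
  define U where "U = (\<lambda>s. \<i> * of_real s) ` ball t e"
  have "?f 0 = 0"
  proof (rule analytic_continuation[where f = ?f])
    show "?f holomorphic_on ?S"
      by (rule D.holomorphic_on_moment_generating[OF int])
    have S_eq: "?S = {z. Re z < c} \<inter> {z. Re z > -c}" by auto
    show "open ?S"
      unfolding S_eq by (intro open_Int open_halfspace_Re_lt open_halfspace_Re_gt)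
    show "connected ?S"
      unfolding S_eq
      by (intro convex_connected convex_Int convex_halfspace_Re_lt convex_halfspace_Re_gt)
    show "U \<subseteq> ?S" "\<i> * of_real t \<in> ?S" "0 \<in> ?S"
      using c by (auto simp: U_def)
    show "?f z = 0" if "z \<in> U" for z
    proof -
      obtain s where s: "z = \<i> * of_real s" "dist t s < e"
        using \<open>z \<in> U\<close> by (auto simp: U_def)
      have "char D s = 0" using eq[of s] e(2)[OF s(2)] by simp
      then show ?thesis using s(1) f_char by simp
    qed
    show "\<i> * of_real t islimpt U"
      unfolding islimpt_approachable
    proof (intro allI impI)
      fix d :: real assume d: "d > 0"
      define s where "s = t + min d e / 2"
      have "s \<in> ball t e" "s \<noteq> t"
        using d e(1) by (auto simp: s_def dist_real_def)
      then have "\<i> * of_real s \<in> U" "s \<noteq> t"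
        by (auto simp: U_def)
      moreover have "dist (\<i> * of_real s) (\<i> * of_real t) = \<bar>s - t\<bar>"
        unfolding dist_norm right_diff_distrib[symmetric] of_real_diff[symmetric] norm_mult norm_of_real by simp
      moreover have "\<bar>s - t\<bar> < d" using d e(1) by (simp add: s_def)
      ultimately show "\<exists>z\<in>U. z \<noteq> \<i> * of_real t \<and> dist z (\<i> * of_real t) < d"
        by (intro bexI[of _ "\<i> * of_real s"]) auto
    qed
  qed
  then show False
    using f_char[of 0] D.char_zero by simp
qed

text \<open>A layer decomposition at integer heights: up to the factor \<open>exp c\<close>, the
  integrand is at most the sum of \<open>exp (c * n)\<close> over the \<open>n\<close> below
  \<open>\<bar>x\<bar>\<close>. By the tail bound, the integrals of the layers are eventually
  dominated by a geometric series of ratio \<open>exp (- (\<alpha> - c))\<close>.\<close>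

lemma (in finite_borel_measure) integrable_exp_abs:
  assumes c: "0 \<le> c" "c < \<alpha>"
    and tail: "\<forall>\<^sub>F n in sequentially. measure M {x. real n \<le> \<bar>x\<bar>} \<le> K * exp (- (\<alpha> * real n))"
  shows "integrable M (\<lambda>x. exp (c * \<bar>x\<bar>))"
proof -
  note [measurable_cong] = M_is_borel
  define h where "h n x = exp (c * real n) * indicator {x. real n \<le> \<bar>x\<bar>} x" for n and x :: real
  have h_fin: "h n x = 0" if "n \<notin> {..nat \<lfloor>\<bar>x\<bar>\<rfloor>}" for n x
    using that by (auto simp: h_def indicator_def le_nat_floor)
  have h_summable: "summable (\<lambda>n. h n x)" for x
    using h_fin by (intro summable_finite[of "{..nat \<lfloor>\<bar>x\<bar>\<rfloor>}"]) auto
  have h_nonneg: "h n x \<ge> 0" for n x by (simp add: h_def)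
  have h_int: "integrable M (h n)" for n
    unfolding h_def by (intro integrable_mult_right integrable_real_indicator) (auto simp: less_top[symmetric])
  have h_integral: "(\<integral>x. norm (h n x) \<partial>M) = exp (c * real n) * measure M {x. real n \<le> \<bar>x\<bar>}" for n
    unfolding h_def by (simp add: abs_mult borel_UNIV)
  have "integrable M (\<lambda>x. \<Sum>n. h n x)"
  proof (rule integrable_suminf[OF h_int])
    show "AE x in M. summable (\<lambda>n. norm (h n x))"
      using h_summable h_nonneg by simp
    have "summable (\<lambda>n. K * exp (- (\<alpha> - c)) ^ n)"
      using c by (intro summable_mult summable_geometric) simp
    then show "summable (\<lambda>n. \<integral>x. norm (h n x) \<partial>M)"
    proof (rule summable_comparison_test_ev[rotated])
      show "\<forall>\<^sub>F n in sequentially. norm (\<integral>x. norm (h n x) \<partial>M) \<le> K * exp (- (\<alpha> - c)) ^ n"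
        using tail
      proof eventually_elim
        case (elim n)
        have "norm (\<integral>x. norm (h n x) \<partial>M) = exp (c * real n) * measure M {x. real n \<le> \<bar>x\<bar>}"
          unfolding h_integral by simp
        also have "\<dots> \<le> exp (c * real n) * (K * exp (- (\<alpha> * real n)))"
          using elim by (intro mult_left_mono) auto
        also have "\<dots> = K * exp (- (\<alpha> - c)) ^ n"
          by (simp add: exp_of_nat_mult[symmetric] exp_add[symmetric] algebra_simps)
        finally show ?case .
      qed
    qed
  qed
  then have "integrable M (\<lambda>x. exp c * (\<Sum>n. h n x))" by simp
  then show ?thesis
  proof (rule Bochner_Integration.integrable_bound)
    show "AE x in M. norm (exp (c * \<bar>x\<bar>)) \<le> norm (exp c * (\<Sum>n. h n x))"
    proof (rule AE_I2)
      fix x :: real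
      \<comment> \<open>The top layer alone suffices: \<open>\<bar>x\<bar>\<close> exceeds its
        integer part by at most 1, which costs the factor \<open>exp c\<close>.\<close>
      define n where "n = nat \<lfloor>\<bar>x\<bar>\<rfloor>"
      have n: "real n \<le> \<bar>x\<bar>" "\<bar>x\<bar> \<le> real n + 1" unfolding n_def by linarith+
      have "c * \<bar>x\<bar> \<le> c + c * real n"
        using mult_left_mono[OF n(2) c(1)] by (simp add: algebra_simps)
      then have "exp (c * \<bar>x\<bar>) \<le> exp c * h n x"
        using n(1) by (simp add: h_def exp_add[symmetric])
      also have "h n x \<le> (\<Sum>n. h n x)"
        using sum_le_suminf[OF h_summable, of "{n}" x] h_nonneg by simp
      finally show "norm (exp (c * \<bar>x\<bar>)) \<le> norm (exp c * (\<Sum>n. h n x))"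
        by simp
    qed
  qed measurable
qed

text \<open>By Fubini, since the exponential of a sum factors. Working on the product with an
  arbitrary \<open>P\<close> lets the first coordinate be an index \<open>n\<close>, with
  \<open>f n\<close> as its location.\<close>

lemma char_distr_pair_add:
  assumes "prob_space P" and "real_distribution D" and [measurable]: "f \<in> borel_measurable P"
  shows "char (distr (P \<Otimes>\<^sub>M D) borel (\<lambda>(x, y). f x + y)) t = char (distr P borel f) t * char D t"
proof -
  interpret P: prob_space P by fact
  interpret D: real_distribution D by fact
  interpret PD: pair_prob_space P D ..
  have "integrable (P \<Otimes>\<^sub>M D) (\<lambda>(x, y). iexp (t * (f x + y)))"
    by (intro PD.integrable_const_bound[where B=1]) auto
  from PD.integral_fst'[OF this]
  have "(\<integral>z. (case z of (x, y) \<Rightarrow> iexp (t * (f x + y))) \<partial>(P \<Otimes>\<^sub>M D))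
      = (\<integral>x. \<integral>y. iexp (t * (f x + y)) \<partial>D \<partial>P)" by simp
  also have "\<dots> = (\<integral>x. iexp (t * f x) * (\<integral>y. iexp (t * y) \<partial>D) \<partial>P)"
    by (simp add: distrib_left exp_add)
  finally show ?thesis
    by (simp add: char_def integral_distr split_beta')
qed

text \<open>Compare the masses of a half-line \<open>{e n..}\<close>. If \<open>d n < e n\<close>,
  then the decreasing sequence \<open>e\<close> lies in it at all indices up to \<open>n\<close>,
  while \<open>d\<close> can lie in it only at indices below \<open>n\<close>. The two masses then
  differ by at least \<open>pmf p n\<close>, which is positive.\<close>

lemma decseq_determined_by_law:
  fixes a b :: "nat \<Rightarrow> real"
  assumes law: "distr (measure_pmf p) borel a = distr (measure_pmf p) borel b"
    and supp: "\<And>n. pmf p n > 0" and "decseq a" "decseq b"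
  shows "a = b"
proof -
  \<comment> \<open>Stated for arbitrary \<open>d\<close> and \<open>e\<close> because it is applied
    in both orders.\<close>
  have not_less: "\<not> d n < e n"
    if "distr (measure_pmf p) borel d = distr (measure_pmf p) borel e"
      and "decseq d" "decseq e" and below: "\<And>k. k < n \<Longrightarrow> d k = e k" for n and d e :: "nat \<Rightarrow> real"
  proof
    assume less: "d n < e n"
    have "measure_pmf.prob p {..<n} + pmf p n = measure_pmf.prob p {..n}"
      by (subst measure_pmf.finite_measure_Union[symmetric, where B="{n}", unfolded measure_pmf_single])
        (auto intro!: arg_cong[where f="measure_pmf.prob p"])
    also have "\<dots> \<le> measure_pmf.prob p (e -` {e n..})"
      using \<open>decseq e\<close> by (intro measure_pmf.finite_measure_mono) (auto simp: decseq_def)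
    also have "\<dots> = measure (distr p borel e) {e n..}"
      by (simp add: measure_distr)
    also have "\<dots> = measure (distr p borel d) {e n..}" by (simp only: that(1))
    also have "\<dots> = measure_pmf.prob p (d -` {e n..})"
      by (simp add: measure_distr)
    also have "\<dots> \<le> measure_pmf.prob p {..<n}"
    proof (intro measure_pmf.finite_measure_mono subsetI)
      fix k assume "k \<in> d -` {e n..}"
      then have "d n < d k" using less by simp
      then show "k \<in> {..<n}"
        using \<open>decseq d\<close> by (metis decseq_def lessThan_iff linorder_not_less)
    qed simp
    finally show False using supp[of n] by simp
  qed
  show "a = b"
  proof (rule ext)
    fix n show "a n = b n"
    proof (induction n rule: less_induct)
      case (less n)
      then show ?case
        using not_less[OF law \<open>decseq a\<close> \<open>decseq b\<close>, of n]
          not_less[OF law[symmetric] \<open>decseq b\<close> \<open>decseq a\<close>, of n] by auto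
    qed
  qed
qed

theorem theorem2p2:
  fixes \<theta> :: "real \<Rightarrow> real" and r a b :: "nat \<Rightarrow> real"
  assumes "\<theta> \<in> {0..} \<rightarrow> {0..}"
    and "mono_on {0..} \<theta>"
    and "\<forall>s\<ge>0. \<forall>t\<ge>0. \<theta> (s + t) \<le> \<theta> s + \<theta> t"
    and "\<theta> 0 = 0"
    and "(\<theta> \<longlongrightarrow> 1) at_top"
    and "absolutely_continuous_map_on {0..} \<theta>"
    and "\<exists>\<alpha>>0. \<exists>m>0. \<exists>M>0. \<exists>C>0.
           (\<forall>t. 0 < t \<and> t < m \<longrightarrow> \<theta> t \<le> C * t powr \<alpha>) \<and>
           (\<forall>t>M. 1 - \<theta> t \<le> C * t powr (- \<alpha>))"
    and "summable r" and "\<forall>n. 0 < r n"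
    and "incseq a" and "\<forall>n. 0 < a n"
    and "incseq b" and "\<forall>n. 0 < b n"
  shows "(\<forall>t>0. (\<Sum>n. r n * \<theta> (t * a n)) = (\<Sum>n. r n * \<theta> (t * b n))) \<longrightarrow> a = b"
proof
  assume eq: "\<forall>t>0. (\<Sum>n. r n * \<theta> (t * a n)) = (\<Sum>n. r n * \<theta> (t * b n))"
  obtain \<alpha> m M C where pos: "\<alpha> > 0" "m > 0" "M > 0" "C > 0"
    and small: "\<And>t. 0 < t \<Longrightarrow> t < m \<Longrightarrow> \<theta> t \<le> C * t powr \<alpha>"
    and large: "\<And>t. t > M \<Longrightarrow> 1 - \<theta> t \<le> C * t powr (- \<alpha>)"
    using assms(7) by blast

  \<comment> \<open>Right-continuity of \<open>\<theta>\<close>\<close>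
  have mono: "\<theta> s \<le> \<theta> t" if "0 \<le> s" "s \<le> t" for s t
    using assms(2) that by (auto simp: mono_on_def)
  have nonneg: "\<theta> t \<ge> 0" if "0 \<le> t" for t
    using assms(1) that by auto
  have at_zero: "(\<theta> \<longlongrightarrow> 0) (at_right 0)"
  proof (rule tendsto_sandwich)
    show "\<forall>\<^sub>F t in at_right 0. 0 \<le> \<theta> t"
      using nonneg by (auto simp: eventually_at_filter)
    show "\<forall>\<^sub>F t in at_right 0. \<theta> t \<le> C * t powr \<alpha>"
      using small pos by (auto simp: eventually_at_right_field)
    show "((\<lambda>t. C * t powr \<alpha>) \<longlongrightarrow> 0) (at_right 0)"
      using pos by real_asymp
  qed simp
  have right_cont: "(\<theta> \<longlongrightarrow> \<theta> s) (at_right s)" if "s \<ge> 0" for s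
  proof (rule tendsto_sandwich)
    show "\<forall>\<^sub>F t in at_right s. \<theta> s \<le> \<theta> t"
      using mono that by (auto simp: eventually_at_filter)
    \<comment> \<open>Subadditivity carries the continuity at 0 over to every point
      \<open>s\<close>.\<close>
    show "\<forall>\<^sub>F t in at_right s. \<theta> t \<le> \<theta> s + \<theta> (t - s)"
      unfolding eventually_at_filter
    proof (intro always_eventually allI impI)
      fix t assume "t \<in> {s<..}"
      then show "\<theta> t \<le> \<theta> s + \<theta> (t - s)"
        using assms(3)[rule_format, of s "t - s"] that by simp
    qed
    have "filterlim (\<lambda>t. t - s) (at_right 0) (at_right s)"
      by (subst at_right_to_0) (simp add: filterlim_filtermap filterlim_ident)
    from tendsto_add[OF tendsto_const filterlim_compose[OF at_zero this]]
    show "((\<lambda>t. \<theta> s + \<theta> (t - s)) \<longlongrightarrow> \<theta> s) (at_right s)" by simp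
  qed simp

  \<comment> \<open>The distribution on the logarithmic scale and its exponential moments\<close>
  define F where "F u = \<theta> (exp u)" for u
  define D where "D = interval_measure F"
  have F_mono: "F x \<le> F y" if "x \<le> y" for x y
    using that by (simp add: F_def mono)
  have F_right_cont: "continuous (at_right u) F" for u
  proof -
    have "filterlim exp (at_right (exp u)) (at_right u)"
      by (auto simp: filterlim_at eventually_at_filter intro!: tendsto_eq_intros)
    from filterlim_compose[OF right_cont this]
    show ?thesis by (simp add: continuous_within F_def[abs_def])
  qed
  have F_bot: "(F \<longlongrightarrow> 0) at_bot"
  proof -
    have "filterlim (exp :: real \<Rightarrow> real) (at_right 0) at_bot"
      by real_asymp
    from filterlim_compose[OF at_zero this] show ?thesis unfolding F_def .
  qed
  have F_top: "(F \<longlongrightarrow> 1) at_top"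
    unfolding F_def by (rule filterlim_compose[OF assms(5) exp_at_top])
  have "real_distribution D"
    unfolding D_def by (intro real_distribution_interval_measure F_mono F_right_cont F_bot F_top)
  then interpret D: real_distribution D .
  have cdf_D: "cdf D = F"
    unfolding D_def by (intro cdf_interval_measure F_mono F_right_cont F_bot)

  \<comment> \<open>The exponent \<open>\<alpha> / 2\<close> is positive, so that the strip is
    nonempty, and strictly below the decay rate \<open>\<alpha>\<close>, so that the geometric
    series converges.\<close>
  have exp_int: "integrable D (\<lambda>x. exp (\<alpha> / 2 * \<bar>x\<bar>))"
  proof (rule D.integrable_exp_abs)
    have ev1: "\<forall>\<^sub>F n in sequentially. exp (- real n) < m"
      using pos by real_asymp
    have ev2: "\<forall>\<^sub>F n in sequentially. exp (real n - 1) > M"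
      using pos by real_asymp
    show "\<forall>\<^sub>F n in sequentially. measure D {x. real n \<le> \<bar>x\<bar>}
            \<le> C * (1 + exp \<alpha>) * exp (- (\<alpha> * real n))"
      using ev1 ev2
    proof eventually_elim
      case (elim n)
      \<comment> \<open>The distribution function gives the mass of closed left half-lines. The
        complement of \<open>{..real n - 1}\<close> is an open half-line that contains the endpoint
        \<open>real n\<close>; the shift by 1 accounts for the factor \<open>exp \<alpha>\<close> in
        the constant.\<close>
      have "measure D {x. real n \<le> \<bar>x\<bar>} \<le> measure D ({..- real n} \<union> (UNIV - {..real n - 1}))"
        by (intro D.finite_measure_mono) auto
      also have "\<dots> \<le> measure D {..- real n} + measure D (UNIV - {..real n - 1})"
        by (intro measure_Un_le) auto
      also have "\<dots> = \<theta> (exp (- real n)) + (1 - \<theta> (exp (real n - 1)))"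
        using D.prob_compl[of "{..real n - 1}"] by (simp add: cdf_def2[symmetric] cdf_D F_def)
      also have "\<dots> \<le> C * exp (- real n) powr \<alpha> + C * exp (real n - 1) powr (- \<alpha>)"
        using elim by (intro add_mono small large) auto
      also have "\<dots> = C * (1 + exp \<alpha>) * exp (- (\<alpha> * real n))"
        by (simp add: powr_def exp_add[symmetric] algebra_simps)
      finally show ?case .
    qed
  qed (use pos in auto)

  \<comment> \<open>Normalised weights and the convolved laws\<close>
  define R where "R = suminf r"
  have R_pos: "R > 0"
    unfolding R_def using assms(8,9) by (intro suminf_pos) auto
  define p where "p = embed_pmf (\<lambda>n. r n / R)"
  have pmf_p: "pmf p n = r n / R" for n
    unfolding p_def
  proof (rule pmf_embed_pmf)
    show "0 \<le> r n / R" for n using assms(9) R_pos by (simp add: less_imp_le)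
    then have "(\<integral>\<^sup>+n. ennreal (r n / R) \<partial>count_space UNIV) = ennreal (\<Sum>n. r n / R)"
      using assms(8) by (simp add: nn_integral_count_space_nat suminf_ennreal2 summable_divide)
    also have "(\<Sum>n. r n / R) = 1"
      using assms(8) R_pos by (simp add: suminf_divide R_def[symmetric])
    finally show "(\<integral>\<^sup>+n. ennreal (r n / R) \<partial>count_space UNIV) = 1" by simp
  qed

  \<comment> \<open>The sign of the logarithm is chosen so that
    \<open>- ln (d n) + y \<le> u\<close> means \<open>y \<le> u + ln (d n)\<close>, an event of
    \<open>D\<close>-probability \<open>F (u + ln (d n)) = \<theta> (exp u * d n)\<close> for
    positive \<open>d n\<close>.\<close>
  define law where "law d = distr (measure_pmf p \<Otimes>\<^sub>M D) borel (\<lambda>(n, y). - ln (d n) + y)" for d :: "nat \<Rightarrow> real"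
  interpret pD: pair_prob_space "measure_pmf p" D ..
  have law_dist: "real_distribution (law d)" for d
    unfolding law_def by (rule pD.real_distribution_distr) measurable
  have law_cdf: "cdf (law d) u = (\<Sum>n. r n * \<theta> (exp u * d n)) / R" if d: "\<forall>n. 0 < d n" for d u
  proof -
    interpret L: real_distribution "law d" by (rule law_dist)
    have nn: "0 \<le> r n / R * \<theta> (exp u * d n)" for n
      using assms(9) R_pos d by (intro mult_nonneg_nonneg nonneg) (auto simp: less_imp_le)
    \<comment> \<open>An increasing function stays below its limit at infinity; this makes
      \<open>r\<close> a summable majorant of the series.\<close>
    have le: "\<theta> t \<le> 1" if "0 \<le> t" for t
      using tendsto_lowerbound[OF assms(5), of "\<theta> t"] mono that
      by (auto simp: eventually_at_top_linorder)
    have summ: "summable (\<lambda>n. r n * \<theta> (exp u * d n))"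
      using assms(8,9) d
      by (intro summable_comparison_test'[OF assms(8)])
        (auto simp: abs_mult nonneg less_imp_le intro!: mult_left_le le)
    have [measurable]: "{(n, y). - ln (d n) + y \<le> u} \<in> sets (measure_pmf p \<Otimes>\<^sub>M D)"
    proof -
      have "{z \<in> space (measure_pmf p \<Otimes>\<^sub>M D). - ln (d (fst z)) + snd z \<le> u}
          \<in> sets (measure_pmf p \<Otimes>\<^sub>M D)"
        by measurable
      then show ?thesis by (simp add: space_pair_measure split_beta')
    qed
    have "emeasure (law d) {..u} = emeasure (measure_pmf p \<Otimes>\<^sub>M D) {(n, y). - ln (d n) + y \<le> u}"
      unfolding law_def by (subst emeasure_distr)
        (auto simp: space_pair_measure vimage_def split_beta' intro!: arg_cong2[where f=emeasure])
    also have "\<dots> = (\<integral>\<^sup>+n. emeasure D {..u + ln (d n)} \<partial>measure_pmf p)"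
      by (subst D.emeasure_pair_measure_alt, measurable)
        (auto simp: vimage_def algebra_simps atMost_def)
    also have "\<dots> = (\<integral>\<^sup>+n. ennreal (\<theta> (exp u * d n)) \<partial>measure_pmf p)"
    proof (rule nn_integral_cong)
      fix n
      show "emeasure D {..u + ln (d n)} = ennreal (\<theta> (exp u * d n))"
        using d by (simp add: D.emeasure_eq_measure cdf_def2[symmetric] cdf_D F_def exp_add)
    qed
    also have "\<dots> = (\<Sum>n. ennreal (r n / R * \<theta> (exp u * d n)))"
      using assms(9) R_pos
      by (simp add: nn_integral_measure_pmf nn_integral_count_space_nat pmf_p ennreal_mult'[symmetric] less_imp_le)
    also have "\<dots> = ennreal (\<Sum>n. r n / R * \<theta> (exp u * d n))"
      using nn summable_divide[OF summ, of R] by (intro suminf_ennreal2) auto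
    also have "(\<Sum>n. r n / R * \<theta> (exp u * d n)) = (\<Sum>n. r n * \<theta> (exp u * d n)) / R"
      using suminf_divide[OF summ, of R] by simp
    finally have "ennreal (cdf (law d) u) = ennreal ((\<Sum>n. r n * \<theta> (exp u * d n)) / R)"
      by (simp add: L.emeasure_eq_measure cdf_def2)
    moreover have "0 \<le> (\<Sum>n. r n * \<theta> (exp u * d n)) / R"
      using nn R_pos summ by (intro divide_nonneg_pos suminf_nonneg) (auto simp: zero_le_mult_iff zero_le_divide_iff)
    ultimately show ?thesis
      by (simp add: cdf_def2)
  qed
  \<comment> \<open>The hypothesis is used at \<open>t = exp u\<close>, which gives equal
    distribution functions at every real \<open>u\<close>.\<close>
  have law_eq: "law a = law b"
    using assms(11,13) eq by (intro cdf_unique law_dist ext) (simp add: law_cdf)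

  \<comment> \<open>Cancelling \<open>D\<close> and recovering the sequences\<close>
  have law_char: "char (law d) t = char (distr p borel (\<lambda>n. - ln (d n))) t * char D t" for d t
    unfolding law_def
    by (rule char_distr_pair_add) (auto intro: measure_pmf.prob_space_axioms D.real_distribution_axioms)
  have "distr p borel (\<lambda>n. - ln (a n)) = distr p borel (\<lambda>n. - ln (b n))"
  proof (rule char_cancel_right[OF _ _ \<open>real_distribution D\<close> _ exp_int])
    show "char (distr p borel (\<lambda>n. - ln (a n))) t * char D t
        = char (distr p borel (\<lambda>n. - ln (b n))) t * char D t" for t
      by (simp add: law_char[symmetric] law_eq)
  qed (use pos in \<open>auto intro: prob_space.real_distribution_distr measure_pmf.prob_space_axioms\<close>)
  \<comment> \<open>The map \<open>- ln\<close> turns increasing positive sequences into decreasing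
    ones, as the uniqueness lemma requires; it is undone by injectivity of \<open>ln\<close> on
    positive reals.\<close>
  then have "(\<lambda>n. - ln (a n)) = (\<lambda>n. - ln (b n))"
    using assms(9-13) R_pos
    by (intro decseq_determined_by_law[of p]) (auto simp: pmf_p decseq_def incseq_def)
  then have "ln (a n) = ln (b n)" for n by (simp add: fun_eq_iff)
  then show "a = b"
    using assms(11,13) by (simp add: fun_eq_iff)
qed

end
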